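(* Consider $F=f+g$ and let the (possibly random) iterates $\mathbf{x}^1,\dots,\mathbf{x}^K$ be generated by the Proximal Arbitrary-Block Descent Method described in the context, from a deterministic $\mathbf{x}^0\in\mathrm{dom}(g)$ and an arbitrary sequence $S_0,\dots,S_{K-1}$ of non-empty (possibly random) subsets of $[n]$. Assume that $F$ is weakly PL with parameter $\rho:\mathbb{R}^n\to\mathbb{R}^+$, i.e. $\mu(\mathbf{x})\ge\rho(\mathbf{y})\,\xi(\mathbf{x})>0$ for all $\mathbf{y},\mathbf{x}\in\mathrm{dom}(g)\setminus\mathcal{X}^*$ with $\xi(\mathbf{x})\le\xi(\mathbf{y})$, where $\mu(\cdot)$ is the proximal forcing function. Let $$\mu_k:=\rho(\mathbf{x}^0)\,\frac{\mathbf{E}[(\xi(\mathbf{x}^k))^2\,\theta(S_k,\mathbf{x}^k)]}{(\mathbf{E}[\xi(\mathbf{x}^k)])^2},\qquad k=0,\dots,K-1 .$$ Then for every $\epsilon>0$, $$\sum_{k=0}^{K-1}\mu_k\ge\frac1\epsilon\quad\Longrightarrow\quad\mathbf{E}[\xi(\mathbf{x}^K)]\le\epsilon .$$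
   Context: Notation: $[n]=\{1,\dots,n\}$, $\bar{\mathbb{R}}=\mathbb{R}\cup\{+\infty\}$, $\mathbb{R}^+$ the positive reals, $\|\cdot\|$ Euclidean norm. For $\emptyset\ne S\subseteq[n]$, $\mathbf{x}_{[S]}\in\mathbb{R}^n$ is $\mathbf{x}$ with entries outside $S$ set to zero, and $\mathbf{M}_{[S]}\in\mathbb{R}^{n\times n}$ is $\mathbf{M}$ with all entries outside the rows and columns in $S$ set to zero. Setup: $f:\mathbb{R}^n\to\mathbb{R}$ is differentiable and $\mathbf{M}$-smooth for a (symmetric) positive definite matrix $\mathbf{M}$: $f(\mathbf{x}+\mathbf{h})\le f(\mathbf{x})+\langle\nabla f(\mathbf{x}),\mathbf{h}\rangle+\frac12\langle\mathbf{M}\mathbf{h},\mathbf{h}\rangle$ for all $\mathbf{x},\mathbf{h}$. $g:\mathbb{R}^n\to\bar{\mathbb{R}}$ is separable: $g(\mathbf{x})=\sum_{i=1}^n g_i(x_i)$ with $g_i:\mathbb{R}\to\bar{\mathbb{R}}$. $F=f+g$ has a global minimizer $\mathbf{x}^*$ with $F(\mathbf{x}^* )>-\infty$; $\mathcal{X}^*=\operatorname{argmin}F$. Standing convention: either $g=0$ (smooth case; $\mathbf{M}$ arbitrary positive definite), or $\mathbf{M}=L\mathbf{I}$ for some $L>0$. In general $L>0$ denotes a constant such that $f$ is $L\mathbf{I}$-smooth (with $\mathbf{M}=L\mathbf{I}$ when $g\neq0$; when $g=0$ the quantities below do not depend on the choice of $L$). Define $U_S(\mathbf{x},\mathbf{u}):=\langle(\nabla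 f(\mathbf{x}))_{[S]},\mathbf{u}\rangle+\frac12\mathbf{u}^\top\mathbf{M}_{[S]}\mathbf{u}+\sum_{i\in S}[g_i(x_i+u_i)-g_i(x_i)]$. Algorithm (Proximal Arbitrary-Block Descent Method): for $k=0,\dots,K-1$, pick a non-empty $S_k\subseteq[n]$ by an arbitrary (deterministic or random, possibly history-dependent) procedure, choose $\mathbf{u}^k\in\operatorname{argmin}_{\mathbf{u}}U_{S_k}(\mathbf{x}^k,\mathbf{u})$, and set $\mathbf{x}^{k+1}=\mathbf{x}^k+\mathbf{u}^k_{[S_k]}$. The minima involved are assumed to be attained (and, in the random case, all iterates are random variables). Functions: optimality gap $\xi(\mathbf{x}):=F(\mathbf{x})-F(\mathbf{x}^* )$; $\lambda(\mathbf{x}):=-L\cdot\min_{\mathbf{y}\in\mathbb{R}^n}\{\langle\nabla f(\mathbf{x}),\mathbf{y}\rangle+\frac L2\|\mathbf{y}\|^2+g(\mathbf{x}+\mathbf{y})-g(\mathbf{x})\}$ (equal to $\frac12\|\nabla f(\mathbf{x})\|^2$ if $g=0$); proximal forcing function $\mu(\mathbf{x}):=\lambda(\mathbf{x})/\xi(\mathbf{x})$ for $\mathbf{x}\in\mathrm{dom}(g)\setminus\mathcal{X}^*$; proportion function $\theta(S,\mathbf{x}):=\frac{-\min_{\mathbf{u}\in\mathbb{R}^n}U_S(\mathbf{x},\mathbf{u})}{\lambda(\mathbf{x})}$ if $\lambda(\mathbf{x})\neq0$, and $\theta(S,\mathbf{x}):=0$ if $\lambda(\mathbf{x})=0$. Degenerate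 convention: $\mu_k:=0$ if $\mathbf{E}[\xi(\mathbf{x}^k)]=0$. *)

theory Defs
  imports "HOL-Probability.Probability"
begin

definition grad :: "(real ^ 'n \<Rightarrow> real) \<Rightarrow> real ^ 'n \<Rightarrow> real ^ 'n" where
  "grad f x = (THE D. GDERIV f x :> D)"

definition vec_block :: "'n set \<Rightarrow> real ^ 'n \<Rightarrow> real ^ 'n" where
  "vec_block S x = (\<chi> i. if i \<in> S then x $ i else 0)"

definition mat_block :: "'n set \<Rightarrow> real ^ 'n ^ 'n \<Rightarrow> real ^ 'n ^ 'n" where
  "mat_block S M = (\<chi> i j. if i \<in> S \<and> j \<in> S then M $ i $ j else 0)"

definition sym_pos_def :: "real ^ 'n ^ 'n \<Rightarrow> bool" where
  "sym_pos_def M \<longleftrightarrow> transpose M = M \<and> (\<forall>h. h \<noteq> 0 \<longrightarrow> (M *v h) \<bullet> h > 0)"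

definition smooth_wrt :: "real ^ 'n ^ 'n \<Rightarrow> (real ^ 'n \<Rightarrow> real) \<Rightarrow> bool" where
  "smooth_wrt M f \<longleftrightarrow>
     (\<forall>x h. f (x + h) \<le> f x + grad f x \<bullet> h + (1/2) * ((M *v h) \<bullet> h))"

text \<open>
  The extended reals \<open>\<real> \<union> {+\<infinity>}\<close> are rendered by \<^typ>\<open>ereal\<close>; a function into them is one
  that never takes the value \<open>-\<infinity>\<close>, which has to be assumed separately. Sums are then
  unproblematic, and the differences below are only ever evaluated at points of the
  domain, where the subtracted term is finite.
\<close>

definition separable_sum :: "('n::finite \<Rightarrow> real \<Rightarrow> ereal) \<Rightarrow> real ^ 'n \<Rightarrow> ereal" where
  "separable_sum gi x = (\<Sum>i\<in>UNIV. gi i (x $ i))"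

definition eff_dom :: "(real ^ 'n \<Rightarrow> ereal) \<Rightarrow> (real ^ 'n) set" where
  "eff_dom g = {x. g x < \<infinity>}"

definition objective ::
  "(real ^ 'n \<Rightarrow> real) \<Rightarrow> ('n::finite \<Rightarrow> real \<Rightarrow> ereal) \<Rightarrow> real ^ 'n \<Rightarrow> ereal" where
  "objective f gi x = ereal (f x) + separable_sum gi x"

definition minimizers :: "(real ^ 'n \<Rightarrow> ereal) \<Rightarrow> (real ^ 'n) set" where
  "minimizers F = {x. is_arg_min F (\<lambda>_. True) x}"

definition block_model ::
  "(real ^ 'n \<Rightarrow> real) \<Rightarrow> ('n::finite \<Rightarrow> real \<Rightarrow> ereal) \<Rightarrow> real ^ 'n ^ 'n \<Rightarrow> 'n set \<Rightarrow>
     real ^ 'n \<Rightarrow> real ^ 'n \<Rightarrow> ereal" where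
  "block_model f gi M S x u =
     ereal (vec_block S (grad f x) \<bullet> u + (1/2) * (u \<bullet> (mat_block S M *v u)))
     + (\<Sum>i\<in>S. gi i (x $ i + u $ i) - gi i (x $ i))"

definition full_model ::
  "(real ^ 'n \<Rightarrow> real) \<Rightarrow> ('n::finite \<Rightarrow> real \<Rightarrow> ereal) \<Rightarrow> real \<Rightarrow>
     real ^ 'n \<Rightarrow> real ^ 'n \<Rightarrow> ereal" where
  "full_model f gi L x y =
     ereal (grad f x \<bullet> y + (L/2) * (norm y)\<^sup>2) + separable_sum gi (x + y) - separable_sum gi x"

text \<open>
  The following functions are real-valued. They are meaningful on the domain of the separable
  part, where all the extended reals being converted are finite. Minima are written as
  infima; that they are attained is a separate assumption.
\<close>

definition gap ::
  "(real ^ 'n \<Rightarrow> real) \<Rightarrow> ('n::finite \<Rightarrow> real \<Rightarrow> ereal) \<Rightarrow> real ^ 'n \<Rightarrow> real ^ 'n \<Rightarrow> real" where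
  "gap f gi xstar x = real_of_ereal (objective f gi x - objective f gi xstar)"

definition lambda_fun ::
  "(real ^ 'n \<Rightarrow> real) \<Rightarrow> ('n::finite \<Rightarrow> real \<Rightarrow> ereal) \<Rightarrow> real \<Rightarrow> real ^ 'n \<Rightarrow> real" where
  "lambda_fun f gi L x = - L * real_of_ereal (INF y. full_model f gi L x y)"

definition prox_forcing ::
  "(real ^ 'n \<Rightarrow> real) \<Rightarrow> ('n::finite \<Rightarrow> real \<Rightarrow> ereal) \<Rightarrow> real \<Rightarrow> real ^ 'n \<Rightarrow> real ^ 'n \<Rightarrow> real" where
  "prox_forcing f gi L xstar x = lambda_fun f gi L x / gap f gi xstar x"

definition proportion ::
  "(real ^ 'n \<Rightarrow> real) \<Rightarrow> ('n::finite \<Rightarrow> real \<Rightarrow> ereal) \<Rightarrow> real ^ 'n ^ 'n \<Rightarrow> real \<Rightarrow>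
     'n set \<Rightarrow> real ^ 'n \<Rightarrow> real" where
  "proportion f gi M L S x =
     (if lambda_fun f gi L x \<noteq> 0
      then - real_of_ereal (INF u. block_model f gi M S x u) / lambda_fun f gi L x
      else 0)"

definition weakly_PL ::
  "(real ^ 'n \<Rightarrow> real) \<Rightarrow> ('n::finite \<Rightarrow> real \<Rightarrow> ereal) \<Rightarrow> real \<Rightarrow> real ^ 'n \<Rightarrow>
     (real ^ 'n \<Rightarrow> real) \<Rightarrow> bool" where
  "weakly_PL f gi L xstar \<rho> \<longleftrightarrow>
     (\<forall>y. \<rho> y > 0) \<and>
     (\<forall>y \<in> eff_dom (separable_sum gi) - minimizers (objective f gi).
      \<forall>x \<in> eff_dom (separable_sum gi) - minimizers (objective f gi).
        gap f gi xstar x \<le> gap f gi xstar y \<longrightarrow>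
          prox_forcing f gi L xstar x \<ge> \<rho> y * gap f gi xstar x \<and> \<rho> y * gap f gi xstar x > 0)"

definition block_descent_step ::
  "(real ^ 'n \<Rightarrow> real) \<Rightarrow> ('n::finite \<Rightarrow> real \<Rightarrow> ereal) \<Rightarrow> real ^ 'n ^ 'n \<Rightarrow> 'n set \<Rightarrow>
     real ^ 'n \<Rightarrow> real ^ 'n \<Rightarrow> bool" where
  "block_descent_step f gi M S x x' \<longleftrightarrow>
     (\<exists>u. is_arg_min (block_model f gi M S x) (\<lambda>_. True) u \<and> x' = x + vec_block S u)"

definition mu_iter ::
  "'w measure \<Rightarrow> (real ^ 'n \<Rightarrow> real) \<Rightarrow> ('n::finite \<Rightarrow> real \<Rightarrow> ereal) \<Rightarrow> real ^ 'n ^ 'n \<Rightarrow>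
     real \<Rightarrow> real ^ 'n \<Rightarrow> (real ^ 'n \<Rightarrow> real) \<Rightarrow> real ^ 'n \<Rightarrow>
     (nat \<Rightarrow> 'w \<Rightarrow> 'n set) \<Rightarrow> (nat \<Rightarrow> 'w \<Rightarrow> real ^ 'n) \<Rightarrow> nat \<Rightarrow> real" where
  "mu_iter P f gi M L xstar \<rho> x0 S x k =
     (if prob_space.expectation P (\<lambda>\<omega>. gap f gi xstar (x k \<omega>)) = 0 then 0
      else \<rho> x0 *
        prob_space.expectation P
          (\<lambda>\<omega>. (gap f gi xstar (x k \<omega>))\<^sup>2 * proportion f gi M L (S k \<omega>) (x k \<omega>))
        / (prob_space.expectation P (\<lambda>\<omega>. gap f gi xstar (x k \<omega>)))\<^sup>2)"

end

theory Submission
  imports Defs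
begin

text \<open>
  A single step satisfies \<open>\<xi>(x') \<le> \<xi>(x) + min U\<^sub>S\<close>, and weak PL turns this into
  \<open>\<xi>(x') \<le> \<xi>(x) - \<rho>(x0) \<xi>(x)\<^sup>2 \<theta>(S, x)\<close>, because \<open>-min U\<^sub>S = \<theta> \<lambda>\<close> and
  \<open>\<lambda> = \<mu> \<xi> \<ge> \<rho>(x0) \<xi>\<^sup>2\<close>. Taking expectations, \<open>e' \<le> e - \<mu>\<^sub>k e\<^sup>2\<close>, so that the bound
  \<open>e (\<mu>\<^sub>0 + \<dots> + \<mu>\<^sub>k\<^sub>-\<^sub>1) \<le> 1\<close> is preserved.
  As nothing makes the functions \<open>gi\<close> measurable, the gaps of the iterates need not be
  integrable, and a Bochner integral that does not exist has the value 0. Hence the bound is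
  kept for an integrable majorant of the gap instead of the gap itself.
\<close>

section \<open>Restriction to a block of coordinates\<close>

lemma vec_block_inner: "vec_block S a \<bullet> b = a \<bullet> vec_block S b"
  by (auto simp: vec_block_def inner_vec_def intro!: sum.cong)

text \<open>The block matrix acts as restriction, then \<open>M\<close>, then restriction again, and
  restriction is self-adjoint.\<close>

lemma mat_block_quadratic:
  "u \<bullet> (mat_block S M *v u) = (M *v vec_block S u) \<bullet> vec_block S u"
proof -
  have "mat_block S M *v u = vec_block S (M *v vec_block S u)"
    by (auto simp: vec_eq_iff mat_block_def vec_block_def matrix_vector_mult_def intro!: sum.cong)
  then show ?thesis
    by (metis inner_commute vec_block_inner)
qed

section \<open>Finiteness on the effective domain\<close>

lemma eff_dom_separable_sum:
  fixes gi :: "'n::finite \<Rightarrow> real \<Rightarrow> ereal"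
  assumes "\<And>i t. gi i t \<noteq> -\<infinity>"
  shows "z \<in> eff_dom (separable_sum gi) \<longleftrightarrow> (\<forall>i. gi i (z $ i) \<noteq> \<infinity>)"
  using assms by (auto simp: eff_dom_def separable_sum_def sum_Pinfty less_top)

lemma eff_dom_separable_sum_coord:
  fixes gi :: "'n::finite \<Rightarrow> real \<Rightarrow> ereal"
  assumes "\<And>i t. gi i t \<noteq> -\<infinity>" and "z \<in> eff_dom (separable_sum gi)"
  shows "gi i (z $ i) = ereal (real_of_ereal (gi i (z $ i)))"
  using assms eff_dom_separable_sum[of gi z] by (cases "gi i (z $ i)") auto

lemma objective_eq_ereal:
  fixes gi :: "'n::finite \<Rightarrow> real \<Rightarrow> ereal"
  assumes "\<And>i t. gi i t \<noteq> -\<infinity>" and "z \<in> eff_dom (separable_sum gi)"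
  shows "objective f gi z = ereal (f z + (\<Sum>i\<in>UNIV. real_of_ereal (gi i (z $ i))))"
proof -
  have "separable_sum gi z = (\<Sum>i\<in>UNIV. ereal (real_of_ereal (gi i (z $ i))))"
    unfolding separable_sum_def by (intro sum.cong refl eff_dom_separable_sum_coord assms)
  then show ?thesis
    by (simp add: objective_def)
qed

lemma eff_dom_iff_objective_finite:
  "z \<in> eff_dom (separable_sum gi) \<longleftrightarrow> objective f gi z \<noteq> \<infinity>"
  by (cases "separable_sum gi z") (auto simp: eff_dom_def objective_def)

text \<open>Makes \<open>0\<close> a competitor, so that the minimum of the model is nonpositive.
  Off the domain this can fail, since \<infinity> - \<infinity> is \<infinity> in
  \<open>ereal\<close>.\<close>

lemma block_model_zero:
  fixes gi :: "'n::finite \<Rightarrow> real \<Rightarrow> ereal"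
  assumes "\<And>i t. gi i t \<noteq> -\<infinity>" and "z \<in> eff_dom (separable_sum gi)"
  shows "block_model f gi M S z 0 = 0"
proof -
  have "gi i (z $ i) - gi i (z $ i) = 0" for i
    by (subst (1 2) eff_dom_separable_sum_coord[OF assms]) simp
  then show ?thesis by (simp add: block_model_def)
qed

text \<open>Smoothness bounds the change of \<open>f\<close> by the quadratic part of the model, and
  separability makes the change of \<open>separable_sum gi\<close> exactly the sum over
  \<open>S\<close>.\<close>

lemma block_descent_step_decrease:
  fixes gi :: "'n::finite \<Rightarrow> real \<Rightarrow> ereal"
  assumes smooth: "smooth_wrt M f"
    and proper: "\<And>i t. gi i t \<noteq> -\<infinity>"
    and dom: "z \<in> eff_dom (separable_sum gi)"
    and step: "block_descent_step f gi M S z z'"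
  obtains m where "(INF u. block_model f gi M S z u) = ereal m" and "m \<le> 0"
    and "z' \<in> eff_dom (separable_sum gi)"
    and "objective f gi z' \<le> objective f gi z + ereal m"
proof -
  obtain u where u: "is_arg_min (block_model f gi M S z) (\<lambda>_. True) u"
    and z': "z' = z + vec_block S u"
    using step by (auto simp: block_descent_step_def)
  define v where "v = vec_block S u"
  define q where "q = grad f z \<bullet> v + (1/2) * ((M *v v) \<bullet> v)"
  define r where "r i t = real_of_ereal (gi i t)" for i t
  have min: "block_model f gi M S z u \<le> block_model f gi M S z y" for y
    using u by (auto simp: is_arg_min_linorder)
  have fin: "gi i (z $ i) = ereal (r i (z $ i))" for i
    unfolding r_def by (rule eff_dom_separable_sum_coord[OF proper dom])
  have model: "block_model f gi M S z u =
      ereal q + (\<Sum>i\<in>S. gi i (z $ i + u $ i) - ereal (r i (z $ i)))"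
    by (simp add: block_model_def vec_block_inner mat_block_quadratic q_def v_def fin)
  have le0: "block_model f gi M S z u \<le> 0"
    using min[of 0] block_model_zero[OF proper dom] by simp
  \<comment> \<open>A single infinite summand would make the model value \<infinity>, against
    \<open>le0\<close>.\<close>
  have "gi i (z $ i + u $ i) \<noteq> \<infinity>" if "i \<in> S" for i
  proof
    assume "gi i (z $ i + u $ i) = \<infinity>"
    then have "(\<Sum>i\<in>S. gi i (z $ i + u $ i) - ereal (r i (z $ i))) = \<infinity>"
      using that by (auto simp: sum_Pinfty intro!: bexI[of _ i])
    with model le0 show False by simp
  qed
  then have finS: "gi i (z $ i + u $ i) = ereal (r i (z $ i + u $ i))" if "i \<in> S" for i
    using that proper[of i "z $ i + u $ i"]
    by (cases "gi i (z $ i + u $ i)") (auto simp: r_def)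
  define m where "m = q + (\<Sum>i\<in>S. r i (z $ i + u $ i) - r i (z $ i))"
  have m: "block_model f gi M S z u = ereal m"
    by (simp add: model finS m_def)
  have coord: "z' $ i = (if i \<in> S then z $ i + u $ i else z $ i)" for i
    by (simp add: z' vec_block_def)
  have dom': "z' \<in> eff_dom (separable_sum gi)"
    unfolding eff_dom_separable_sum[OF proper] by (auto simp: coord fin finS)
  have "(\<Sum>i\<in>UNIV. r i (z' $ i)) - (\<Sum>i\<in>UNIV. r i (z $ i)) =
      (\<Sum>i\<in>UNIV. if i \<in> S then r i (z $ i + u $ i) - r i (z $ i) else 0)"
    unfolding sum_subtractf[symmetric] by (intro sum.cong) (auto simp: coord)
  also have "\<dots> = (\<Sum>i\<in>S. r i (z $ i + u $ i) - r i (z $ i))"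
    by (simp flip: sum.inter_restrict[of UNIV _ S, simplified])
  finally have sums: "(\<Sum>i\<in>UNIV. r i (z' $ i)) - (\<Sum>i\<in>UNIV. r i (z $ i)) =
      (\<Sum>i\<in>S. r i (z $ i + u $ i) - r i (z $ i))" .
  have "f z' \<le> f z + q"
    using smooth unfolding smooth_wrt_def z' v_def q_def add.assoc[symmetric] by blast
  then have "objective f gi z' \<le> objective f gi z + ereal m"
    using sums
    by (simp add: objective_eq_ereal[OF proper dom] objective_eq_ereal[OF proper dom'] m_def
        flip: r_def)
  moreover have "(INF u. block_model f gi M S z u) = ereal m"
    using min by (intro antisym) (auto intro: INF_lower2[of u] INF_greatest simp flip: m)
  ultimately show thesis
    using that[of m] le0 m dom' by simp
qed

section \<open>The optimality gap and its decrease in one step\<close>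

lemma gap_nonneg:
  fixes gi :: "'n::finite \<Rightarrow> real \<Rightarrow> ereal"
  assumes "xstar \<in> minimizers (objective f gi)"
  shows "0 \<le> gap f gi xstar z"
proof -
  have "objective f gi xstar \<le> objective f gi z"
    using assms by (auto simp: minimizers_def is_arg_min_linorder)
  then show ?thesis
    \<comment> \<open>If either value is infinite, the difference is \<infinity>, which
      \<open>real_of_ereal\<close> sends to 0; so \<open>z\<close> may lie outside the
      domain.\<close>
    unfolding gap_def
    by (cases "objective f gi xstar"; cases "objective f gi z") auto
qed

lemma minimizers_eff_dom:
  fixes gi :: "'n::finite \<Rightarrow> real \<Rightarrow> ereal"
  assumes "xstar \<in> minimizers (objective f gi)" and "z \<in> eff_dom (separable_sum gi)"
  shows "xstar \<in> eff_dom (separable_sum gi)"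
proof -
  have "objective f gi xstar \<le> objective f gi z"
    using assms by (auto simp: minimizers_def is_arg_min_linorder)
  with assms(2) show ?thesis
    unfolding eff_dom_iff_objective_finite[of _ gi f] by auto
qed

text \<open>Gives access to weak PL, which speaks of non-minimizers only. The domain matters: the
  gap is also 0 where the objective is \<infinity>.\<close>

lemma gap_eq_zero_iff:
  fixes gi :: "'n::finite \<Rightarrow> real \<Rightarrow> ereal"
  assumes "\<And>i t. gi i t \<noteq> -\<infinity>"
    and min: "xstar \<in> minimizers (objective f gi)"
    and "z \<in> eff_dom (separable_sum gi)"
  shows "gap f gi xstar z = 0 \<longleftrightarrow> z \<in> minimizers (objective f gi)"
proof -
  have "xstar \<in> eff_dom (separable_sum gi)"
    using minimizers_eff_dom assms(2,3) .
  then have "gap f gi xstar z = 0 \<longleftrightarrow> objective f gi z = objective f gi xstar"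
    using assms by (auto simp: gap_def objective_eq_ereal)
  also have "\<dots> \<longleftrightarrow> z \<in> minimizers (objective f gi)"
    using min by (auto simp: minimizers_def is_arg_min_linorder intro: antisym)
  finally show ?thesis .
qed

text \<open>Weak PL is applied with the reference point \<open>x0\<close> throughout, which requires
  \<open>le0\<close>; the first two conclusions carry \<open>dom\<close> and \<open>le0\<close> over
  to the next step.\<close>

lemma block_descent_step_gap:
  fixes gi :: "'n::finite \<Rightarrow> real \<Rightarrow> ereal"
  assumes smooth: "smooth_wrt M f"
    and proper: "\<And>i t. gi i t \<noteq> -\<infinity>"
    and min: "xstar \<in> minimizers (objective f gi)"
    and wPL: "weakly_PL f gi L xstar \<rho>"
    and dom0: "x0 \<in> eff_dom (separable_sum gi)"
    and dom: "z \<in> eff_dom (separable_sum gi)"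
    and le0: "gap f gi xstar z \<le> gap f gi xstar x0"
    and step: "block_descent_step f gi M S z z'"
  shows "z' \<in> eff_dom (separable_sum gi)"
    and "gap f gi xstar z' \<le> gap f gi xstar z"
    and "gap f gi xstar z' \<le>
      gap f gi xstar z - \<rho> x0 * ((gap f gi xstar z)\<^sup>2 * proportion f gi M L S z)"
proof -
  let ?\<xi> = "gap f gi xstar" and ?lam = "lambda_fun f gi L z"
  obtain m where m: "(INF u. block_model f gi M S z u) = ereal m" "m \<le> 0"
    and dom': "z' \<in> eff_dom (separable_sum gi)"
    and dec: "objective f gi z' \<le> objective f gi z + ereal m"
    using block_descent_step_decrease[OF smooth proper dom step] .
  have "xstar \<in> eff_dom (separable_sum gi)"
    using minimizers_eff_dom min dom0 .
  with dec have gap': "?\<xi> z' \<le> ?\<xi> z + m"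
    using proper dom dom' by (simp add: gap_def objective_eq_ereal)
  show "z' \<in> eff_dom (separable_sum gi)" by (fact dom')
  show "?\<xi> z' \<le> ?\<xi> z" using gap' m by simp
  show "?\<xi> z' \<le> ?\<xi> z - \<rho> x0 * ((?\<xi> z)\<^sup>2 * proportion f gi M L S z)"
  proof (cases "?\<xi> z = 0")
    case True
    then show ?thesis using gap' m by simp
  next
    case False
    then have pos: "?\<xi> z > 0"
      using gap_nonneg[OF min, of z] by simp
    with le0 have "?\<xi> x0 \<noteq> 0" by simp
    then have "x0 \<notin> minimizers (objective f gi)" "z \<notin> minimizers (objective f gi)"
      using False gap_eq_zero_iff[OF proper min] dom dom0 by auto
    then have PL: "prox_forcing f gi L xstar z \<ge> \<rho> x0 * ?\<xi> z" and "\<rho> x0 > 0"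
      using wPL dom dom0 le0 by (auto simp: weakly_PL_def)
    have lam: "\<rho> x0 * (?\<xi> z)\<^sup>2 \<le> ?lam"
      using PL pos by (simp add: prox_forcing_def field_simps power2_eq_square)
    moreover have "0 < \<rho> x0 * (?\<xi> z)\<^sup>2"
      using pos \<open>\<rho> x0 > 0\<close> by simp
    ultimately have lam_pos: "?lam > 0" by linarith
    \<comment> \<open>Here \<open>- m\<close> is the proportion times \<open>?lam\<close>; the
      factor in front of it is at most 1 by \<open>lam\<close>.\<close>
    have "\<rho> x0 * ((?\<xi> z)\<^sup>2 * proportion f gi M L S z) = (\<rho> x0 * (?\<xi> z)\<^sup>2 / ?lam) * (- m)"
      using lam_pos m by (simp add: proportion_def)
    also have "\<dots> \<le> 1 * (- m)"
      using lam lam_pos m by (intro mult_right_mono) auto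
    finally show ?thesis using gap' by simp
  qed
qed

text \<open>Product form of the growth of the reciprocal of \<open>e\<close> by at least
  \<open>m\<close>; it allows the new value to be 0. With \<open>t = m * e\<close> it reduces to
  \<open>(1 - t) * (1 + t) \<le> 1\<close>.\<close>

lemma reciprocal_rate_step:
  fixes e m s :: real
  assumes "0 < e" and "0 \<le> e - m * e\<^sup>2" and "e * s \<le> 1"
  shows "(e - m * e\<^sup>2) * (s + m) \<le> 1"
proof -
  have "0 \<le> e * (1 - m * e)"
    using assms(2) by (simp add: algebra_simps power2_eq_square)
  then have "0 \<le> 1 - m * e"
    using assms(1) by (simp add: zero_le_mult_iff)
  then have "(1 - m * e) * (e * s + m * e) \<le> (1 - m * e) * (1 + m * e)"
    using assms(3) by (intro mult_left_mono) auto
  also have "\<dots> = 1 - (m * e)\<^sup>2"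
    by (simp add: algebra_simps power2_eq_square)
  also have "\<dots> \<le> 1"
    by simp
  finally show ?thesis
    by (simp add: algebra_simps power2_eq_square)
qed

section \<open>Expected gap along the iterates\<close>

theorem theorem19:
  fixes f :: "real ^ 'n \<Rightarrow> real"
    and gi :: "'n \<Rightarrow> real \<Rightarrow> ereal"
    and M :: "real ^ 'n ^ 'n"
    and L :: real
    and xstar x0 :: "real ^ 'n"
    and \<rho> :: "real ^ 'n \<Rightarrow> real"
    and P :: "'w measure"
    and K :: nat
    and S :: "nat \<Rightarrow> 'w \<Rightarrow> 'n set"
    and x :: "nat \<Rightarrow> 'w \<Rightarrow> real ^ 'n"
    and \<epsilon> :: real
  assumes f_differentiable: "\<And>z. f differentiable (at z)"
    and M_pos_def: "sym_pos_def M"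
    and f_smooth: "smooth_wrt M f"
    and L_pos: "L > 0"
    and f_L_smooth: "smooth_wrt (L *\<^sub>R mat 1) f"
    and gi_proper: "\<And>i t. gi i t \<noteq> -\<infinity>"
    and convention: "(\<forall>z. separable_sum gi z = 0) \<or> M = L *\<^sub>R mat 1"
    and minimizer: "xstar \<in> minimizers (objective f gi)"
    and min_finite: "objective f gi xstar > -\<infinity>"
    and lambda_attained:
      "\<And>z. z \<in> eff_dom (separable_sum gi) \<Longrightarrow>
         \<exists>y. is_arg_min (full_model f gi L z) (\<lambda>_. True) y"
    and wPL: "weakly_PL f gi L xstar \<rho>"
    and prob: "prob_space P"
    and x0_dom: "x0 \<in> eff_dom (separable_sum gi)"
    and x_init: "\<And>\<omega>. \<omega> \<in> space P \<Longrightarrow> x 0 \<omega> = x0"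
    and x_random: "\<And>k. k \<le> K \<Longrightarrow> x k \<in> borel_measurable P"
    and S_random: "\<And>k. k < K \<Longrightarrow> S k \<in> measurable P (count_space UNIV)"
    and S_nonempty: "\<And>k \<omega>. k < K \<Longrightarrow> \<omega> \<in> space P \<Longrightarrow> S k \<omega> \<noteq> {}"
    and x_step:
      "\<And>k \<omega>. k < K \<Longrightarrow> \<omega> \<in> space P \<Longrightarrow>
         block_descent_step f gi M (S k \<omega>) (x k \<omega>) (x (Suc k) \<omega>)"
    and eps_pos: "\<epsilon> > 0"
  shows "(\<Sum>k<K. mu_iter P f gi M L xstar \<rho> x0 S x k) \<ge> 1 / \<epsilon> \<longrightarrow>
           prob_space.expectation P (\<lambda>\<omega>. gap f gi xstar (x K \<omega>)) \<le> \<epsilon>"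
proof
  interpret prob_space P by (fact prob)
  let ?\<xi> = "gap f gi xstar" and ?mu = "mu_iter P f gi M L xstar \<rho> x0 S x"
  assume sum: "1 / \<epsilon> \<le> (\<Sum>k<K. ?mu k)"
  have inv: "x k \<omega> \<in> eff_dom (separable_sum gi) \<and> ?\<xi> (x k \<omega>) \<le> ?\<xi> x0"
    if "k \<le> K" "\<omega> \<in> space P" for k \<omega>
    using that
  proof (induction k)
    case 0
    then show ?case using x_init x0_dom by simp
  next
    case (Suc k)
    then have "block_descent_step f gi M (S k \<omega>) (x k \<omega>) (x (Suc k) \<omega>)"
      and "x k \<omega> \<in> eff_dom (separable_sum gi)" "?\<xi> (x k \<omega>) \<le> ?\<xi> x0"
      using x_step by auto
    then show ?case
      using block_descent_step_gap(1,2)[OF f_smooth gi_proper minimizer wPL x0_dom]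
      by (meson order_trans)
  qed
  note gap_step = block_descent_step_gap[OF f_smooth gi_proper minimizer wPL x0_dom]
  have bound: "\<exists>Z. integrable P Z \<and> (\<forall>\<omega>\<in>space P. ?\<xi> (x k \<omega>) \<le> Z \<omega>) \<and>
      expectation Z * (\<Sum>j<k. ?mu j) \<le> 1" if "k \<le> K" for k
    using that
  proof (induction k)
    case 0
    then show ?case
      \<comment> \<open>The initial gap is deterministic, and the empty sum makes the product
        0.\<close>
      using x_init by (intro exI[of _ "\<lambda>_. ?\<xi> x0"]) auto
  next
    case (Suc k)
    then obtain Z where Z: "integrable P Z" "\<And>\<omega>. \<omega> \<in> space P \<Longrightarrow> ?\<xi> (x k \<omega>) \<le> Z \<omega>"
      and EZ: "expectation Z * (\<Sum>j<k. ?mu j) \<le> 1"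
      by auto
    let ?\<xi>k = "\<lambda>\<omega>. ?\<xi> (x k \<omega>)"
    let ?\<theta>k = "\<lambda>\<omega>. (?\<xi> (x k \<omega>))\<^sup>2 * proportion f gi M L (S k \<omega>) (x k \<omega>)"
    have mono: "?\<xi> (x (Suc k) \<omega>) \<le> ?\<xi>k \<omega>"
      and dec: "?\<xi> (x (Suc k) \<omega>) \<le> ?\<xi>k \<omega> - \<rho> x0 * ?\<theta>k \<omega>" if "\<omega> \<in> space P" for \<omega>
      using gap_step(2,3)[of "x k \<omega>" "S k \<omega>" "x (Suc k) \<omega>"]
        inv[of k \<omega>] x_step[of k \<omega>] that Suc.prems by auto
    show ?case
    \<comment> \<open>A zero \<open>?mu k\<close> covers the degenerate convention and a vanishing
      or nonexistent integral of \<open>?\<theta>k\<close>. The sum then stays the same, and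
      \<open>Z\<close> still works by \<open>mono\<close>.\<close>
    proof (cases "?mu k = 0")
      case True
      then show ?thesis
        using Z EZ mono by (intro exI[of _ Z]) (auto intro: order_trans)
    next
      case False
      define e where "e = expectation ?\<xi>k"
      have "e \<noteq> 0" and mu: "?mu k = \<rho> x0 * expectation ?\<theta>k / e\<^sup>2"
        using False by (auto simp: mu_iter_def e_def split: if_splits)
      have E\<theta>: "expectation ?\<theta>k \<noteq> 0"
        using False mu by auto
      \<comment> \<open>A nonzero Bochner integral certifies integrability.\<close>
      have int: "integrable P ?\<xi>k" "integrable P ?\<theta>k"
        using \<open>e \<noteq> 0\<close> E\<theta> not_integrable_integral_eq unfolding e_def by blast+
      have "0 \<le> e"
        unfolding e_def by (intro integral_nonneg_AE AE_I2 gap_nonneg[OF minimizer])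
      then have "e > 0" using \<open>e \<noteq> 0\<close> by simp
      \<comment> \<open>Built from the true gap rather than from \<open>Z\<close>, so that its
        expectation is exactly \<open>e - ?mu k * e\<^sup>2\<close>.\<close>
      define Z' where "Z' \<omega> = ?\<xi>k \<omega> - \<rho> x0 * ?\<theta>k \<omega>" for \<omega>
      have gap_le: "?\<xi> (x (Suc k) \<omega>) \<le> Z' \<omega>" if "\<omega> \<in> space P" for \<omega>
        unfolding Z'_def using dec that .
      have "integrable P Z'"
        unfolding Z'_def using int by auto
      have EZ': "expectation Z' = e - ?mu k * e\<^sup>2"
        unfolding Z'_def using int \<open>e \<noteq> 0\<close> by (simp add: mu e_def)
      have "0 \<le> expectation Z'"
        using gap_le gap_nonneg[OF minimizer]
        by (intro integral_nonneg_AE AE_I2) (meson order_trans)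
      have "e \<le> expectation Z"
        unfolding e_def using int Z by (intro integral_mono) auto
      have "e * (\<Sum>j<k. ?mu j) \<le> 1"
      \<comment> \<open>Replacing \<open>expectation Z\<close> by the smaller \<open>e\<close> is
        monotone only for a nonnegative sum; for a negative one the product is negative
        anyway.\<close>
      proof (cases "(\<Sum>j<k. ?mu j) \<ge> 0")
        case True
        then show ?thesis
          using \<open>e \<le> expectation Z\<close> EZ by (meson mult_right_mono order_trans)
      next
        case False
        then show ?thesis
          using \<open>e > 0\<close> by (smt (verit) mult_pos_neg)
      qed
      then have "expectation Z' * (\<Sum>j<Suc k. ?mu j) \<le> 1"
        using reciprocal_rate_step[OF \<open>e > 0\<close>] \<open>0 \<le> expectation Z'\<close> by (simp add: EZ')
      then show ?thesis
        using \<open>integrable P Z'\<close> gap_le by blast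
    qed
  qed
  obtain Z where Z: "integrable P Z" "\<And>\<omega>. \<omega> \<in> space P \<Longrightarrow> ?\<xi> (x K \<omega>) \<le> Z \<omega>"
    and EZ: "expectation Z * (\<Sum>j<K. ?mu j) \<le> 1"
    using bound[OF order_refl] by auto
  have "0 \<le> expectation Z"
    using Z gap_nonneg[OF minimizer] by (intro integral_nonneg_AE AE_I2) (meson order_trans)
  then have "expectation Z * (1 / \<epsilon>) \<le> 1"
    using sum EZ by (meson mult_left_mono order_trans)
  then have "expectation Z \<le> \<epsilon>"
    using eps_pos by (simp add: field_simps)
  \<comment> \<open>If the last gap is not integrable, its expectation is 0 by default, which
    nonnegativity of \<open>expectation Z\<close> covers.\<close>
  moreover have "expectation (\<lambda>\<omega>. ?\<xi> (x K \<omega>)) \<le> expectation Z"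
    using Z gap_nonneg[OF minimizer] \<open>0 \<le> expectation Z\<close>
    by (cases "integrable P (\<lambda>\<omega>. ?\<xi> (x K \<omega>))")
       (auto intro: integral_mono simp: not_integrable_integral_eq)
  ultimately show "expectation (\<lambda>\<omega>. ?\<xi> (x K \<omega>)) \<le> \<epsilon>" by linarith
qed

end
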